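(* Let $A\in\mathbb{R}^{n\times n}$, $C=I\in\mathbb{R}^{n\times n}$, $N\ge1$, let $L=W_o$ be the observability Gramian over horizon $N$ with eigenvalues $\lambda_1,\dots,\lambda_n$, let $\mathcal{Y}=\{1,\dots,n\}$, and let $r<n$ be a budget. Consider the $k$-DPP maximum a posteriori (MAP) problem $$Y^\star\in\arg\max_{Y\subseteq\mathcal{Y},\,|Y|=r}\mathcal{P}_L^r(Y),\qquad \mathcal{P}^r_L(Y)=\frac{\det(L_Y)}{e_r(\lambda_1,\dots,\lambda_n)},$$ where $e_r(\lambda_1,\dots,\lambda_n)=\sum_{|Y'|=r}\det(L_{Y'})$ is the $r$-th elementary symmetric polynomial of the eigenvalues of $L$. Then solving this problem is equivalent to solving the node selection problem $$Y^\star\in\arg\max_{Y\subseteq\mathcal{Y},\,|Y|=r}\log\det\big((W_o)_Y\big),$$ i.e. the two problems have the same set of maximizers.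
   Context: For $x[k+1]=Ax[k]+Bu[k]$, $y[k]=Cx[k]$, the observability Gramian over horizon $N$ is $W_o=\sum_{k=0}^{N-1}(A^k)^\top C^\top CA^k\in\mathbb{R}^{n\times n}$. For a matrix $M$ and an index set $Y$, $M_Y=[M_{ij}]_{i,j\in Y}$ is the principal submatrix, with $\det(M_\emptyset)=1$. The $k$-DPP $\mathcal{P}^r_L$ is the probability measure on subsets of $\mathcal{Y}$ of cardinality exactly $r$ given by the displayed formula. *)

theory Defs
  imports "Jordan_Normal_Form.Char_Poly" "Jordan_Normal_Form.DL_Submatrix"
begin

text \<open>Indices are 0-based: the ground set of an \<open>n \<times> n\<close> matrix is \<open>{..<n}\<close>.\<close>

(* Summed entrywise because matrices of unspecified dimension have no zero element. *)
definition obs_gramian :: "real mat \<Rightarrow> real mat \<Rightarrow> nat \<Rightarrow> real mat" where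
  "obs_gramian A C N =
     mat (dim_row A) (dim_row A)
       (\<lambda>(i, j). \<Sum>k<N. ((A ^\<^sub>m k)\<^sup>T * C\<^sup>T * C * A ^\<^sub>m k) $$ (i, j))"

(* The determinant of the 0 x 0 matrix principal_submatrix M {} is 1. *)
abbreviation principal_submatrix :: "'a mat \<Rightarrow> nat set \<Rightarrow> 'a mat" where
  "principal_submatrix M Y \<equiv> submatrix M Y Y"

definition elem_sym :: "nat \<Rightarrow> nat \<Rightarrow> (nat \<Rightarrow> real) \<Rightarrow> real" where
  "elem_sym n r lam = (\<Sum>S | S \<subseteq> {..<n} \<and> card S = r. \<Prod>i\<in>S. lam i)"

(* lam lists the eigenvalues of M with algebraic multiplicity, in any order. *)
definition eigenvalue_listing :: "real mat \<Rightarrow> (nat \<Rightarrow> real) \<Rightarrow> bool" where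
  "eigenvalue_listing M lam \<longleftrightarrow> char_poly M = (\<Prod>i<dim_row M. [:- lam i, 1:])"

(* The mass function of the k-DPP with kernel L, whose eigenvalues are lam;
   only its values on sets Y of cardinality r are meaningful. *)
definition kdpp :: "real mat \<Rightarrow> (nat \<Rightarrow> real) \<Rightarrow> nat \<Rightarrow> nat set \<Rightarrow> real" where
  "kdpp L lam r Y = det (principal_submatrix L Y) / elem_sym (dim_row L) r lam"

end

(* The coefficient of x^(n-r) in the characteristic polynomial of L, read off from the Leibniz
   expansion of det (x I - L) on one side and from the product of linear factors x - lam i on the
   other, identifies e_r(lam) with the sum of the principal r-minors. With C = I the Gramian
   is I plus a sum of matrices B^T B, hence positive definite, so every principal minor is positive.
   The mass function is then a positive multiple of det L_Y, and ln is strictly increasing there. *)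
theory Submission
  imports Defs
begin

section \<open>Principal submatrices and their determinants\<close>

lemma dim_principal_submatrix:
  assumes "M \<in> carrier_mat n n" "S \<subseteq> {..<n}"
  shows "principal_submatrix M S \<in> carrier_mat (card S) (card S)"
proof -
  have "{i. i < n \<and> i \<in> S} = S"
    using assms(2) by blast
  with assms(1) show ?thesis
    by (simp only: carrier_mat_def mem_Collect_eq dim_submatrix)
qed

lemma principal_submatrix_index:
  assumes "M \<in> carrier_mat n n" "S \<subseteq> {..<n}" "a < card S" "b < card S"
  shows "principal_submatrix M S $$ (a, b) = M $$ (pick S a, pick S b)"
proof (rule submatrix_index)
  show "a < card {i. i < dim_row M \<and> i \<in> S}" "b < card {j. j < dim_col M \<and> j \<in> S}"
    using dim_principal_submatrix[OF assms(1,2)] assms(3,4)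
    by (simp_all only: carrier_mat_def mem_Collect_eq dim_submatrix)
qed

text \<open>\<open>pick S\<close> lists a finite set in increasing order, hence injectively, and an
  injective image inside \<open>S\<close> of size \<open>card S\<close> exhausts
  \<open>S\<close>.\<close>

lemma bij_betw_pick:
  assumes "finite S"
  shows "bij_betw (pick S) {0..<card S} S"
proof -
  have inj: "inj_on (pick S) {0..<card S}"
    by (rule linorder_inj_onI) (auto dest: pick_mono_le[rotated])
  have "pick S ` {0..<card S} \<subseteq> S"
    by (rule image_subsetI) (simp add: pick_in_set_le)
  then have "pick S ` {0..<card S} = S"
    by (rule card_subset_eq[OF assms]) (simp add: card_image[OF inj])
  with inj show ?thesis
    by (simp add: bij_betw_def)
qed

text \<open>Conjugation by \<open>f\<close> is undone by conjugation by its inverse. This carries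
  Leibniz sums from positions in a submatrix to the original indices.\<close>

lemma bij_betw_map_permutation:
  assumes "bij_betw f A B"
  shows "bij_betw (map_permutation A f) {p. p permutes A} {p. p permutes B}"
proof (rule bij_betw_byWitness)
  let ?g = "inv_into A f"
  have g: "bij_betw ?g B A"
    by (rule bij_betw_inv_into) fact
  show "\<forall>p\<in>{p. p permutes A}. map_permutation B ?g (map_permutation A f p) = p"
    using assms by (auto intro!: map_permutation_compose_inv simp: bij_betw_def)
  show "\<forall>q\<in>{p. p permutes B}. map_permutation A f (map_permutation B ?g q) = q"
    using assms g by (auto intro!: map_permutation_compose_inv simp: bij_betw_inv_into_right)
  show "map_permutation A f ` {p. p permutes A} \<subseteq> {p. p permutes B}"
    using assms by (auto intro: map_permutation_permutes)
  show "map_permutation B ?g ` {p. p permutes B} \<subseteq> {p. p permutes A}"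
    using g by (auto intro: map_permutation_permutes)
qed

text \<open>The Leibniz sum over positions is transported along \<open>pick S\<close>, and
  conjugation preserves signs. Indexing by \<open>S\<close> itself allows permutations of different
  subsets to be compared inside \<open>{..<n}\<close>.\<close>

lemma det_principal_submatrix:
  fixes M :: "'a :: comm_ring_1 mat"
  assumes M: "M \<in> carrier_mat n n" and S: "S \<subseteq> {..<n}"
  shows "det (principal_submatrix M S) =
    (\<Sum>p | p permutes S. signof p * (\<Prod>i\<in>S. M $$ (i, p i)))"
proof -
  let ?I = "{0..<card S}" and ?f = "pick S"
  have f: "bij_betw ?f ?I S"
    using S by (intro bij_betw_pick) (auto intro: finite_subset)
  have "(\<Sum>q | q permutes S. signof q * (\<Prod>i\<in>S. M $$ (i, q i))) =
    (\<Sum>p | p permutes ?I. signof (map_permutation ?I ?f p) *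
       (\<Prod>i\<in>S. M $$ (i, map_permutation ?I ?f p i)))"
    by (rule sum.reindex_bij_betw[OF bij_betw_map_permutation[OF f], symmetric])
  also have "\<dots> = (\<Sum>p | p permutes ?I. signof p *
      (\<Prod>a\<in>?I. principal_submatrix M S $$ (a, p a)))"
  proof (rule sum.cong[OF refl])
    fix p assume "p \<in> {p. p permutes ?I}"
    then have p: "p permutes ?I" by simp
    have inj: "inj_on ?f ?I"
      using f by (rule bij_betw_imp_inj_on)
    have "(\<Prod>i\<in>S. M $$ (i, map_permutation ?I ?f p i)) =
        (\<Prod>a\<in>?I. M $$ (?f a, map_permutation ?I ?f p (?f a)))"
      by (rule prod.reindex_bij_betw[OF f, symmetric])
    also have "\<dots> = (\<Prod>a\<in>?I. principal_submatrix M S $$ (a, p a))"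
    proof (rule prod.cong[OF refl])
      fix a assume a: "a \<in> ?I"
      then have "p a \<in> ?I"
        using permutes_in_image[OF p] by blast
      with a show "M $$ (?f a, map_permutation ?I ?f p (?f a)) =
          principal_submatrix M S $$ (a, p a)"
        using principal_submatrix_index[OF M S] by (simp add: map_permutation_apply[OF inj])
    qed
    finally show "signof (map_permutation ?I ?f p) *
        (\<Prod>i\<in>S. M $$ (i, map_permutation ?I ?f p i)) =
      signof p * (\<Prod>a\<in>?I. principal_submatrix M S $$ (a, p a))"
      using inj p by (simp add: sign_map_permutation)
  qed
  also have "\<dots> = det (principal_submatrix M S)"
    using det_def'[OF dim_principal_submatrix[OF M S]] by simp
  finally show ?thesis ..
qed

section \<open>Elementary symmetric polynomials as sums of principal minors\<close>

text \<open>Each factor of a Leibniz term is a constant, plus x at a fixed point. Expanding over the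
  set \<open>S\<close> of indices where the constant is chosen, then collecting the permutations for
  each \<open>S\<close>, produces the principal minors.\<close>

lemma char_poly_principal_minors:
  fixes M :: "'a :: comm_ring_1 mat"
  assumes M: "M \<in> carrier_mat n n"
  shows "char_poly M = (\<Sum>S\<in>Pow {..<n}.
    monom ((- 1) ^ card S * det (principal_submatrix M S)) (n - card S))"
proof -
  have prod_eq: "(\<Prod>i<n. char_poly_matrix M $$ (i, p i)) =
     (\<Sum>S\<in>Pow {..<n}. if p permutes S
        then monom ((- 1) ^ card S * (\<Prod>i\<in>S. M $$ (i, p i))) (n - card S) else 0)"
    if p: "p permutes {..<n}" for p
  proof -
    have "(\<Prod>i<n. char_poly_matrix M $$ (i, p i)) =
      (\<Prod>i<n. [:- M $$ (i, p i):] + (if p i = i then monom 1 1 else 0))"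
      using M permutes_in_image[OF p]
      by (intro prod.cong) (auto simp: char_poly_matrix_def monom_altdef)
    also have "\<dots> = (\<Sum>S\<in>Pow {..<n}. (\<Prod>i\<in>S. [:- M $$ (i, p i):]) *
        (\<Prod>i\<in>{..<n} - S. if p i = i then monom 1 1 else 0))"
      by (rule prod_add) simp
    also have "\<dots> = (\<Sum>S\<in>Pow {..<n}. if p permutes S
        then monom ((- 1) ^ card S * (\<Prod>i\<in>S. M $$ (i, p i))) (n - card S) else 0)"
    proof (rule sum.cong[OF refl])
      fix S assume "S \<in> Pow {..<n}"
      then have S: "S \<subseteq> {..<n}" "finite S"
        by (auto intro: finite_subset)
      have const: "(\<Prod>i\<in>S. [:- M $$ (i, p i):]) =
          monom ((- 1) ^ card S * (\<Prod>i\<in>S. M $$ (i, p i))) 0"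
        by (simp add: prod_uminus[symmetric] monom_0 prod_to_poly)
      show "(\<Prod>i\<in>S. [:- M $$ (i, p i):]) *
          (\<Prod>i\<in>{..<n} - S. if p i = i then monom 1 1 else 0) =
        (if p permutes S
         then monom ((- 1) ^ card S * (\<Prod>i\<in>S. M $$ (i, p i))) (n - card S) else 0)"
      proof (cases "p permutes S")
        case True
        have "(\<Prod>i\<in>{..<n} - S. if p i = i then monom 1 1 else 0 :: 'a poly) =
            (\<Prod>i\<in>{..<n} - S. monom 1 1)"
          using permutes_not_in[OF True] by (intro prod.cong) auto
        also have "\<dots> = monom 1 (n - card S)"
          using S by (simp add: card_Diff_subset monom_power)
        finally show ?thesis
          using True by (simp add: const mult_monom)
      next
        case False
        \<comment> \<open>Fixing every index outside \<open>S\<close> would make \<open>p\<close> a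
          permutation of \<open>S\<close>; so some index there is moved, and its factor is
          zero.\<close>
        then have "\<exists>i\<in>{..<n} - S. p i \<noteq> i"
          using permutes_superset[OF p] by blast
        then have "(\<Prod>i\<in>{..<n} - S. if p i = i then monom 1 1 else 0 :: 'a poly) = 0"
          by (intro prod_zero) auto
        with False show ?thesis by simp
      qed
    qed
    finally show ?thesis .
  qed
  \<comment> \<open>The sign is a polynomial on the left and a scalar on the right, so the values 1
    and -1 are treated separately.\<close>
  have signof_monom: "signof p * monom c k = monom (signof p * c) k"
    for p :: "nat \<Rightarrow> nat" and c :: 'a and k
    by (cases p rule: sign_cases) (simp_all add: minus_monom)
  have "char_poly M = (\<Sum>p | p permutes {..<n}.
      signof p * (\<Prod>i<n. char_poly_matrix M $$ (i, p i)))"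
    unfolding char_poly_def using det_def'[OF char_poly_matrix_closed[OF M]]
    by (simp add: atLeast0LessThan)
  also have "\<dots> = (\<Sum>p | p permutes {..<n}. \<Sum>S\<in>Pow {..<n}. if p permutes S
      then monom ((- 1) ^ card S * (signof p * (\<Prod>i\<in>S. M $$ (i, p i)))) (n - card S) else 0)"
    by (intro sum.cong refl)
       (auto simp: prod_eq sum_distrib_left signof_monom mult.left_commute intro!: sum.cong)
  also have "\<dots> = (\<Sum>S\<in>Pow {..<n}. \<Sum>p | p permutes {..<n}. if p permutes S
      then monom ((- 1) ^ card S * (signof p * (\<Prod>i\<in>S. M $$ (i, p i)))) (n - card S) else 0)"
    by (rule sum.swap)
  also have "\<dots> = (\<Sum>S\<in>Pow {..<n}.
      monom ((- 1) ^ card S * det (principal_submatrix M S)) (n - card S))"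
  proof (rule sum.cong[OF refl])
    fix S assume "S \<in> Pow {..<n}"
    then have S: "S \<subseteq> {..<n}" by simp
    \<comment> \<open>Permutations are total functions that are the identity outside their set, so
      those of \<open>S\<close> are literally among those of \<open>{..<n}\<close>; all other terms
      are zero.\<close>
    have "(\<Sum>p | p permutes {..<n}. if p permutes S
        then monom ((- 1) ^ card S * (signof p * (\<Prod>i\<in>S. M $$ (i, p i)))) (n - card S) else 0) =
      (\<Sum>p | p permutes S.
        monom ((- 1) ^ card S * (signof p * (\<Prod>i\<in>S. M $$ (i, p i)))) (n - card S))"
      using S by (intro sum.mono_neutral_cong_right)
        (auto simp: finite_permutations intro: permutes_subset)
    then show "(\<Sum>p | p permutes {..<n}. if p permutes S
        then monom ((- 1) ^ card S * (signof p * (\<Prod>i\<in>S. M $$ (i, p i)))) (n - card S) else 0) =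
      monom ((- 1) ^ card S * det (principal_submatrix M S)) (n - card S)"
      by (simp add: det_principal_submatrix[OF M S] sum_distrib_left monom_hom.hom_sum)
  qed
  finally show ?thesis .
qed

text \<open>The product is expanded by the same choice of \<open>S\<close> and kept in the same
  shape as \<open>char_poly_principal_minors\<close>, so that one coefficient formula serves
  both.\<close>

lemma prod_linear_factors:
  fixes lam :: "nat \<Rightarrow> 'a :: comm_ring_1"
  shows "(\<Prod>i<n. [:- lam i, 1:]) =
    (\<Sum>S\<in>Pow {..<n}. monom ((- 1) ^ card S * (\<Prod>i\<in>S. lam i)) (n - card S))"
proof -
  have "(\<Prod>i<n. [:- lam i, 1:]) = (\<Prod>i<n. [:- lam i:] + monom 1 1)"
    by (simp add: monom_altdef)
  also have "\<dots> = (\<Sum>S\<in>Pow {..<n}. (\<Prod>i\<in>S. [:- lam i:]) * (\<Prod>i\<in>{..<n} - S. monom 1 1))"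
    by (rule prod_add) simp
  also have "\<dots> = (\<Sum>S\<in>Pow {..<n}. monom ((- 1) ^ card S * (\<Prod>i\<in>S. lam i)) (n - card S))"
  proof (rule sum.cong[OF refl])
    fix S assume "S \<in> Pow {..<n}"
    then have "S \<subseteq> {..<n}" "finite S"
      by (auto intro: finite_subset)
    then have "(\<Prod>i\<in>{..<n} - S. monom 1 1 :: 'a poly) = monom 1 (n - card S)"
      by (simp add: card_Diff_subset monom_power)
    moreover have "(\<Prod>i\<in>S. [:- lam i:]) = monom ((- 1) ^ card S * (\<Prod>i\<in>S. lam i)) 0"
      by (simp add: prod_uminus[symmetric] monom_0 prod_to_poly)
    ultimately show "(\<Prod>i\<in>S. [:- lam i:]) * (\<Prod>i\<in>{..<n} - S. monom 1 1) =
        monom ((- 1) ^ card S * (\<Prod>i\<in>S. lam i)) (n - card S)"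
      by (simp add: mult_monom)
  qed
  finally show ?thesis .
qed

text \<open>Subtraction of naturals truncates, but \<open>r\<close> and all subset sizes are at most
  \<open>n\<close>, so degree \<open>n - r\<close> selects exactly the subsets of size
  \<open>r\<close>.\<close>

lemma coeff_sum_Pow_monom:
  fixes c :: "nat set \<Rightarrow> 'a :: comm_ring_1"
  assumes "r \<le> n"
  shows "coeff (\<Sum>S\<in>Pow {..<n}. monom ((- 1) ^ card S * c S) (n - card S)) (n - r) =
    (- 1) ^ r * (\<Sum>S | S \<subseteq> {..<n} \<and> card S = r. c S)"
proof -
  have "card S \<le> n" if "S \<subseteq> {..<n}" for S
    using card_mono[OF _ that] by simp
  then have "n - card S = n - r \<longleftrightarrow> card S = r" if "S \<subseteq> {..<n}" for S
    using assms that by (metis diff_diff_cancel)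
  then have "coeff (\<Sum>S\<in>Pow {..<n}. monom ((- 1) ^ card S * c S) (n - card S)) (n - r) =
      (\<Sum>S | S \<subseteq> {..<n} \<and> card S = r. (- 1) ^ r * c S)"
    unfolding coeff_sum by (intro sum.mono_neutral_cong_right) auto
  then show ?thesis
    by (simp add: sum_distrib_left)
qed

lemma elem_sym_eq_sum_principal_minors:
  assumes M: "M \<in> carrier_mat n n" and "eigenvalue_listing M lam" "r \<le> n"
  shows "elem_sym n r lam =
    (\<Sum>S | S \<subseteq> {..<n} \<and> card S = r. det (principal_submatrix M S))"
proof -
  have "char_poly M = (\<Prod>i<n. [:- lam i, 1:])"
    using assms by (simp add: eigenvalue_listing_def)
  from arg_cong[OF this, of "\<lambda>p. coeff p (n - r)"] show ?thesis
    unfolding char_poly_principal_minors[OF M] prod_linear_factors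
      coeff_sum_Pow_monom[OF \<open>r \<le> n\<close>] elem_sym_def by simp
qed

section \<open>Positivity of the principal minors of the Gramian\<close>

text \<open>The characteristic polynomial of \<open>- M\<close> is monic and takes the value
  \<open>det M\<close> at 0. Were this value nonpositive, there would be a root x \<ge> 0, and an
  eigenvector \<open>v\<close> of \<open>- M\<close> for x would make the quadratic form of
  \<open>M\<close> nonpositive.\<close>

lemma positive_definite_det_pos:
  fixes M :: "real mat"
  assumes M: "M \<in> carrier_mat m m"
    and pos: "\<And>v. v \<in> carrier_vec m \<Longrightarrow> v \<noteq> 0\<^sub>v m \<Longrightarrow> v \<bullet> (M *\<^sub>v v) > 0"
  shows "det M > 0"
proof (rule ccontr)
  assume "\<not> det M > 0"
  let ?p = "char_poly (- M)"
  have M': "- M \<in> carrier_mat m m"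
    using M by simp
  have "- char_matrix (- M) 0 = M"
    using M by (intro eq_matI) (auto simp: char_matrix_def)
  then have p0: "poly ?p 0 \<le> 0"
    using char_poly_matrix[OF M', of 0] \<open>\<not> det M > 0\<close> by simp
  have "lead_coeff ?p = 1"
    using degree_monic_char_poly[OF M'] by simp
  then obtain k where k: "\<And>x. x \<ge> k \<Longrightarrow> poly ?p x \<ge> 1"
    using poly_pinfty_gt_lc[of ?p] by auto
  \<comment> \<open>The bound \<open>k\<close> may be negative; \<open>max k 0\<close> keeps the
    interval starting at 0 nonempty.\<close>
  have "\<exists>x\<ge>0. x \<le> max k 0 \<and> poly ?p x = 0"
    using k[of "max k 0"] p0 by (intro IVT) auto
  then obtain x where x: "x \<ge> 0" "poly ?p x = 0"
    by blast
  then obtain v where "eigenvector (- M) v x"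
    using eigenvalue_root_char_poly[OF M'] by (auto simp: eigenvalue_def)
  then have v: "v \<in> carrier_vec m" "v \<noteq> 0\<^sub>v m" "- M *\<^sub>v v = x \<cdot>\<^sub>v v"
    using M by (auto simp: eigenvector_def)
  have "- (v \<bullet> (M *\<^sub>v v)) = v \<bullet> (- M *\<^sub>v v)"
    using M v(1) by simp
  also have "\<dots> = x * (v \<bullet> v)"
    using v by simp
  also have "\<dots> \<ge> 0"
    using x by (simp add: scalar_prod_def sum_nonneg)
  finally show False
    using pos[OF v(1,2)] by simp
qed

lemma obs_gramian_carrier:
  "A \<in> carrier_mat n n \<Longrightarrow> obs_gramian A C N \<in> carrier_mat n n"
  by (simp add: obs_gramian_def)

text \<open>With \<open>C = I\<close> each summand is a Gram matrix, whose entries are inner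
  products of columns of \<open>A ^\<^sub>m k\<close>.\<close>

lemma obs_gramian_identity_index:
  assumes A: "A \<in> carrier_mat n n" and "i < n" "j < n"
  shows "obs_gramian A (1\<^sub>m n) N $$ (i, j) =
    (\<Sum>k<N. \<Sum>l<n. (A ^\<^sub>m k) $$ (l, i) * (A ^\<^sub>m k) $$ (l, j))"
proof -
  have "((A ^\<^sub>m k)\<^sup>T * (1\<^sub>m n)\<^sup>T * 1\<^sub>m n * A ^\<^sub>m k) $$ (i, j) =
      (\<Sum>l<n. (A ^\<^sub>m k) $$ (l, i) * (A ^\<^sub>m k) $$ (l, j))" for k
  proof -
    have "A ^\<^sub>m k \<in> carrier_mat n n"
      using A by simp
    then show ?thesis
      using assms by (simp add: scalar_prod_def atLeast0LessThan)
  qed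
  then show ?thesis
    using assms by (simp add: obs_gramian_def)
qed

text \<open>The matrix is a sum of rank-one matrices, one for each vector \<open>g k l\<close>, and
  each contributes the square of an inner product with \<open>v\<close>.\<close>

lemma quadratic_form_sum_squares:
  fixes v :: "'a \<Rightarrow> real"
  shows "(\<Sum>a\<in>I. v a * (\<Sum>b\<in>I. (\<Sum>k\<in>K. \<Sum>l\<in>J. g k l a * g k l b) * v b)) =
    (\<Sum>k\<in>K. \<Sum>l\<in>J. (\<Sum>a\<in>I. v a * g k l a)\<^sup>2)"
proof -
  have "(\<Sum>a\<in>I. v a * (\<Sum>b\<in>I. (\<Sum>k\<in>K. \<Sum>l\<in>J. g k l a * g k l b) * v b)) =
    (\<Sum>a\<in>I. \<Sum>b\<in>I. \<Sum>k\<in>K. \<Sum>l\<in>J. (v a * g k l a) * (v b * g k l b))"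
    by (simp add: sum_distrib_left sum_distrib_right mult_ac)
  \<comment> \<open>Moving the sums over \<open>k\<close> and \<open>l\<close> outermost leaves a
    double sum that factors into two equal sums.\<close>
  also have "\<dots> = (\<Sum>a\<in>I. \<Sum>k\<in>K. \<Sum>b\<in>I. \<Sum>l\<in>J. (v a * g k l a) * (v b * g k l b))"
    by (intro sum.cong refl sum.swap)
  also have "\<dots> = (\<Sum>k\<in>K. \<Sum>a\<in>I. \<Sum>l\<in>J. \<Sum>b\<in>I. (v a * g k l a) * (v b * g k l b))"
    by (subst sum.swap) (intro sum.cong refl sum.swap)
  also have "\<dots> = (\<Sum>k\<in>K. \<Sum>l\<in>J. \<Sum>a\<in>I. \<Sum>b\<in>I. (v a * g k l a) * (v b * g k l b))"
    by (intro sum.cong refl sum.swap)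
  finally show ?thesis
    by (simp add: power2_eq_square sum_product)
qed

text \<open>The quadratic form of the submatrix is a sum of squares, and its \<open>k = 0\<close>
  part, present because \<open>N \<ge> 1\<close>, comes from the identity matrix and is positive for
  nonzero \<open>v\<close>.\<close>

lemma det_principal_submatrix_obs_gramian_pos:
  assumes A: "A \<in> carrier_mat n n" and "N \<ge> 1" and Y: "Y \<subseteq> {..<n}"
  shows "det (principal_submatrix (obs_gramian A (1\<^sub>m n) N) Y) > 0"
proof (rule positive_definite_det_pos)
  let ?L = "obs_gramian A (1\<^sub>m n) N" and ?m = "card Y"
  note L = obs_gramian_carrier[OF A]
  show M: "principal_submatrix ?L Y \<in> carrier_mat ?m ?m"
    by (rule dim_principal_submatrix[OF L Y])
  fix v :: "real vec" assume v: "v \<in> carrier_vec ?m" "v \<noteq> 0\<^sub>v ?m"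
  let ?g = "\<lambda>k l a. (A ^\<^sub>m k) $$ (l, pick Y a)"
  have pick: "pick Y a < n" if "a < ?m" for a
    using pick_in_set_le[OF that] Y by auto
  have inj: "inj_on (pick Y) {0..<?m}"
    using Y by (intro bij_betw_imp_inj_on[OF bij_betw_pick]) (auto intro: finite_subset)
  from v obtain c where c: "c < ?m" "v $ c \<noteq> 0"
    by (auto simp: vec_eq_iff)
  have "v \<bullet> (principal_submatrix ?L Y *\<^sub>v v) =
    (\<Sum>a<?m. v $ a * (\<Sum>b<?m. (\<Sum>k<N. \<Sum>l<n. ?g k l a * ?g k l b) * v $ b))"
  proof -
    have "v \<bullet> (principal_submatrix ?L Y *\<^sub>v v) =
        (\<Sum>a<?m. v $ a * (\<Sum>b<?m. principal_submatrix ?L Y $$ (a, b) * v $ b))"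
      using M v(1) by (simp add: scalar_prod_def atLeast0LessThan)
    also have "\<dots> = (\<Sum>a<?m. v $ a * (\<Sum>b<?m. (\<Sum>k<N. \<Sum>l<n. ?g k l a * ?g k l b) * v $ b))"
      by (intro sum.cong arg_cong2[of _ _ _ _ "(*)"] refl)
         (simp add: principal_submatrix_index[OF L Y] obs_gramian_identity_index[OF A] pick)
    finally show ?thesis .
  qed
  also have "\<dots> = (\<Sum>k<N. \<Sum>l<n. (\<Sum>a<?m. v $ a * ?g k l a)\<^sup>2)"
    by (rule quadratic_form_sum_squares)
  also have "\<dots> > 0"
  proof -
    \<comment> \<open>Row \<open>pick Y c\<close> of the zeroth power, the identity, isolates the
      nonzero coordinate \<open>v $ c\<close>; this single square already makes the whole sum
      positive.\<close>
    have "pick Y a = pick Y c \<longleftrightarrow> a = c" if "a < ?m" for a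
      using inj_on_eq_iff[OF inj, of a c] that c(1) by simp
    then have "?g 0 (pick Y c) a = (if a = c then 1 else 0)" if "a < ?m" for a
      using A that pick[OF that] pick[OF c(1)] by (auto dest: sym)
    then have "(\<Sum>a<?m. v $ a * ?g 0 (pick Y c) a) = (\<Sum>a<?m. if a = c then v $ c else 0)"
      by (intro sum.cong) auto
    then have "(\<Sum>a<?m. v $ a * ?g 0 (pick Y c) a)\<^sup>2 > 0"
      using c by simp
    then have inner: "(\<Sum>l<n. (\<Sum>a<?m. v $ a * ?g 0 l a)\<^sup>2) > 0"
      by (rule sum_pos2[rotated 2]) (use pick[OF c(1)] in auto)
    show ?thesis
      by (rule sum_pos2[where i = 0, rotated 2])
         (use \<open>N \<ge> 1\<close> inner in \<open>simp_all add: sum_nonneg\<close>)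
  qed
  finally show "v \<bullet> (principal_submatrix ?L Y *\<^sub>v v) > 0" .
qed

section \<open>Equality of the two sets of maximizers\<close>

theorem proposition2:
  fixes A C L :: "real mat" and n N r :: nat and lam :: "nat \<Rightarrow> real"
  assumes "A \<in> carrier_mat n n"
    and "C = 1\<^sub>m n"
    and "N \<ge> 1"
    and "L = obs_gramian A C N"
    and "eigenvalue_listing L lam"
    and "r < n"
  shows "elem_sym n r lam =
           (\<Sum>Y | Y \<subseteq> {..<n} \<and> card Y = r. det (principal_submatrix L Y)) \<and>
         {Y. is_arg_max (kdpp L lam r) (\<lambda>Y. Y \<subseteq> {..<n} \<and> card Y = r) Y} =
         {Y. is_arg_max (\<lambda>Y. ln (det (principal_submatrix (obs_gramian A C N) Y)))
               (\<lambda>Y. Y \<subseteq> {..<n} \<and> card Y = r) Y}"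
proof
  have L: "L \<in> carrier_mat n n"
    unfolding \<open>L = obs_gramian A C N\<close> by (rule obs_gramian_carrier) fact
  have pos: "det (principal_submatrix L Y) > 0" if "Y \<subseteq> {..<n}" for Y
    unfolding \<open>L = obs_gramian A C N\<close> \<open>C = 1\<^sub>m n\<close>
    by (rule det_principal_submatrix_obs_gramian_pos) fact+
  show elem_sym: "elem_sym n r lam =
      (\<Sum>Y | Y \<subseteq> {..<n} \<and> card Y = r. det (principal_submatrix L Y))"
    using \<open>r < n\<close> by (intro elem_sym_eq_sum_principal_minors[OF L \<open>eigenvalue_listing L lam\<close>]) simp
  \<comment> \<open>A witness that some subset has size \<open>r\<close>: an empty sum of minors
    would not give a strictly positive normalizer.\<close>
  have "{..<r} \<in> {Y. Y \<subseteq> {..<n} \<and> card Y = r}"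
    using \<open>r < n\<close> by auto
  then have "{Y. Y \<subseteq> {..<n} \<and> card Y = r} \<noteq> {}"
    by blast
  moreover have "finite {Y. Y \<subseteq> {..<n} \<and> card Y = r}"
    by simp
  ultimately have "elem_sym n r lam > 0"
    unfolding elem_sym using pos by (intro sum_pos) simp_all
  \<comment> \<open>Both objectives order the subsets alike: the normalizer is a positive constant,
    as \<open>dim_row L = n\<close>, and \<open>ln\<close> reflects the order because both minors
    are positive.\<close>
  then have "kdpp L lam r Y \<le> kdpp L lam r Z \<longleftrightarrow>
      ln (det (principal_submatrix L Y)) \<le> ln (det (principal_submatrix L Z))"
    if "Y \<subseteq> {..<n}" "Z \<subseteq> {..<n}" for Y Z
    using carrier_matD(1)[OF L] pos[OF that(1)] pos[OF that(2)]
    by (simp add: kdpp_def divide_le_cancel)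
  then show "{Y. is_arg_max (kdpp L lam r) (\<lambda>Y. Y \<subseteq> {..<n} \<and> card Y = r) Y} =
      {Y. is_arg_max (\<lambda>Y. ln (det (principal_submatrix (obs_gramian A C N) Y)))
               (\<lambda>Y. Y \<subseteq> {..<n} \<and> card Y = r) Y}"
    \<comment> \<open>In a linear order, having no strictly better competitor means dominating every
      competitor, so the equivalence of the two orderings applies directly.\<close>
    unfolding is_arg_max_linorder \<open>L = obs_gramian A C N\<close>[symmetric] by blast
qed

end
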